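(* Let $\mathcal X$ be a real Hilbert space and let $f\colon \mathcal X\to\mathbb R$ be convex and differentiable with a gradient $\nabla f\colon\mathcal X\to\mathcal X$ that is $\beta^{-1}$-Lipschitz continuous for some $\beta>0$. Let $x_0\in\mathcal X$, let $(\alpha_n)_{n\ge 0}$ be a sequence of positive numbers with $\alpha_n\le 1$ for all $n\ge 0$, and let $(x_n)_{n\ge 0}$ and $(\Delta x_n)_{n\ge 0}$ be sequences in $\mathcal X$ such that, for all $n\ge 0$, $$x_{n+1} = x_n-\beta\bigl(\nabla f(x_n)+\Delta x_n\bigr)\qquad\text{and}\qquad \|\Delta x_n\|\le \alpha_n\|\nabla f(x_n)\|.$$ Then the following hold. 1. The sequence $(f(x_n))_{n\ge 0}$ is non-increasing. 2. For every global minimizer $\bar x$ of $f$ and all $n\ge 0$, $$f(x_n)-f(\bar x)\le \frac{1}{2\beta}\left(\prod_{k=0}^{n-1}\left(1-\frac{1-\alpha_k^2}{k+2}\right)\right)\|x_0-\bar x\|^2 .$$ 3. If in addition $$\sum_{n=0}^\infty\frac{1-\alpha_n}{n+2}=+\infty,$$ then $f(x_n)\to f(\bar x)$ as $n\to+\infty$, where $\bar x$ is any global minimizer of $f$.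
   Context: $\|\cdot\|$ denotes the norm induced by the inner product of $\mathcal X$. Differentiable means Fréchet differentiable, with the derivative identified with the gradient $\nabla f$ via the inner product. The empty product (case $n=0$) equals $1$. *)

theory Defs
  imports "HOL-Analysis.Analysis"
begin

end

theory Submission
  imports Defs
begin

text \<open>
  After rescaling we may take \<open>\<beta> = 1\<close>. Write \<open>g\<^sub>n\<close> for the gradient at \<open>x\<^sub>n\<close>, \<open>e\<^sub>n\<close> for the error,
  \<open>D\<^sub>n = f x\<^sub>n - f xbar\<close>, \<open>K\<^sub>n\<close> for twice the claimed bound on \<open>D\<^sub>n\<close>, and let
  \<open>y\<^sub>n = x\<^sub>n - g\<^sub>n\<close> be the exact gradient step. The distance of \<open>x\<^sub>n\<close> to \<open>xbar\<close> may grow too fast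
  to be a Lyapunov quantity (errors can move \<open>x\<^sub>n\<close> without decreasing \<open>f\<close>), but that of \<open>y\<^sub>n\<close> is
  controlled: by induction
  \<open>\<parallel>y\<^sub>n - xbar\<parallel>\<^sup>2 \<le> (n + 1) (K\<^sub>n - 2 D\<^sub>n)\<close>, whence \<open>D\<^sub>n \<le> K\<^sub>n / 2\<close>.
  The only property of \<open>f\<close> used is the cocoercivity-type inequality
  \<open>f b + \<langle>\<nabla>f b, a - b\<rangle> + \<parallel>\<nabla>f a - \<nabla>f b\<parallel>\<^sup>2 / 2 \<le> f a\<close>.
\<close>

section \<open>First-order inequalities for convex functions with Lipschitz gradient\<close>

lemma gderiv_along_line:
  fixes f :: "'a::real_inner \<Rightarrow> real"
  assumes "GDERIV f (a + t *\<^sub>R d) :> g"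
  shows "((\<lambda>t. f (a + t *\<^sub>R d)) has_real_derivative inner d g) (at t)"
proof -
  have "(f has_derivative (\<lambda>h. inner h g)) (at (a + t *\<^sub>R d))"
    using assms by (simp add: gderiv_def)
  moreover have "((\<lambda>t. a + t *\<^sub>R d) has_derivative (\<lambda>h. h *\<^sub>R d)) (at t)"
    by (auto intro!: derivative_eq_intros)
  ultimately have "((\<lambda>t. f (a + t *\<^sub>R d)) has_derivative (\<lambda>h. inner (h *\<^sub>R d) g)) (at t)"
    by (rule has_derivative_compose[rotated])
  then show ?thesis
    by (simp add: has_field_derivative_def mult_commute_abs)
qed

text \<open>Convexity bounds the difference quotients at \<open>b\<close> towards \<open>a\<close>
  by \<open>f a - f b\<close>; let \<open>t\<close> tend to \<open>0\<close> from the right.\<close>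

lemma convex_gderiv_lower_bound:
  fixes f :: "'a::real_inner \<Rightarrow> real"
  assumes "convex_on UNIV f" and "GDERIV f b :> g"
  shows "f b + inner g (a - b) \<le> f a"
proof -
  define \<phi> where "\<phi> = (\<lambda>t. f (b + t *\<^sub>R (a - b)))"
  have "(\<phi> has_real_derivative inner (a - b) g) (at 0)"
    unfolding \<phi>_def using assms(2) by (intro gderiv_along_line) simp
  then have "(\<lambda>t. (\<phi> t - \<phi> 0) / t) \<midarrow>0\<rightarrow> inner (a - b) g"
    by (simp add: DERIV_def)
  then have "((\<lambda>t. (\<phi> t - \<phi> 0) / t) \<longlongrightarrow> inner (a - b) g) (at_right 0)"
    by (rule filterlim_mono) (auto simp: at_within_le_at)
  moreover have "\<forall>\<^sub>F t in at_right 0. (\<phi> t - \<phi> 0) / t \<le> f a - f b"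
    unfolding eventually_at_right_field
  proof (intro exI[of _ 1] conjI allI impI)
    fix t :: real assume t: "0 < t" "t < 1"
    have "\<phi> t = f ((1 - t) *\<^sub>R b + t *\<^sub>R a)"
      by (simp add: \<phi>_def algebra_simps)
    also have "\<dots> \<le> (1 - t) * f b + t * f a"
      using t by (intro convex_onD[OF assms(1)]) auto
    finally show "(\<phi> t - \<phi> 0) / t \<le> f a - f b"
      using t by (simp add: \<phi>_def field_simps)
  qed simp
  ultimately have "inner (a - b) g \<le> f a - f b"
    by (intro tendsto_upperbound[where F = "at_right 0"]) auto
  then show ?thesis
    by (simp add: inner_commute)
qed

lemma descent_lemma:
  fixes f :: "'a::real_inner \<Rightarrow> real"
  assumes gd: "\<And>y. GDERIV f y :> grad y" and lip: "L-lipschitz_on UNIV grad"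
  shows "f b \<le> f a + inner (grad a) (b - a) + L / 2 * (norm (b - a))\<^sup>2"
proof -
  define d where "d = b - a"
  \<comment> \<open>Up to a constant, this is \<open>f\<close> on the segment minus its quadratic
    upper model. Cauchy-Schwarz and the Lipschitz bound make its derivative nonpositive on
    \<open>[0, 1]\<close>.\<close>
  define \<phi> where "\<phi> = (\<lambda>t. f (a + t *\<^sub>R d) - t * inner d (grad a) - L / 2 * t\<^sup>2 * (norm d)\<^sup>2)"
  have "\<phi> 1 \<le> \<phi> 0"
  proof (rule DERIV_nonpos_imp_nonincreasing[of 0 1 \<phi>])
    fix t :: real assume t: "0 \<le> t" "t \<le> 1"
    let ?D = "inner d (grad (a + t *\<^sub>R d)) - inner d (grad a) - L * t * (norm d)\<^sup>2"
    have "(\<phi> has_real_derivative ?D) (at t)"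
      unfolding \<phi>_def by (auto intro!: derivative_eq_intros gderiv_along_line gd)
    moreover have "?D \<le> 0"
    proof -
      have "inner d (grad (a + t *\<^sub>R d) - grad a) \<le> norm d * norm (grad (a + t *\<^sub>R d) - grad a)"
        by (rule norm_cauchy_schwarz)
      also have "\<dots> \<le> norm d * (L * norm (t *\<^sub>R d))"
        using lipschitz_onD[OF lip, of "a + t *\<^sub>R d" a]
        by (intro mult_left_mono) (auto simp: dist_norm)
      also have "\<dots> = L * t * (norm d)\<^sup>2"
        using t by (simp add: power2_eq_square)
      finally show ?thesis
        by (simp add: inner_diff_right)
    qed
    ultimately show "\<exists>y. (\<phi> has_real_derivative y) (at t) \<and> y \<le> 0"
      by blast
  qed simp
  then show ?thesis
    by (simp add: \<phi>_def d_def inner_commute)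
qed

text \<open>The tangent plane at \<open>b\<close> bounds \<open>f z\<close> from below and the
  quadratic model at \<open>a\<close> bounds it from above; at a well-chosen \<open>z\<close> the
  gap is the squared gradient difference.\<close>

lemma convex_lipschitz_gradient_lower_bound:
  fixes f :: "'a::real_inner \<Rightarrow> real"
  assumes cvx: "convex_on UNIV f" and gd: "\<And>y. GDERIV f y :> grad y"
    and \<beta>: "\<beta> > 0" and lip: "(inverse \<beta>)-lipschitz_on UNIV grad"
  shows "f b + inner (grad b) (a - b) + \<beta> / 2 * (norm (grad a - grad b))\<^sup>2 \<le> f a"
proof -
  define r where "r = grad a - grad b"
  \<comment> \<open>This \<open>z\<close> minimizes the upper model at \<open>a\<close> minus the
    tangent plane at \<open>b\<close>, which makes the comparison as strong as possible.\<close>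
  define z where "z = a - \<beta> *\<^sub>R r"
  have "f b + inner (grad b) (z - b) \<le> f z"
    by (rule convex_gderiv_lower_bound[OF cvx gd])
  also have "f z \<le> f a + inner (grad a) (z - a) + inverse \<beta> / 2 * (norm (z - a))\<^sup>2"
    by (rule descent_lemma[OF gd lip])
  also have "inverse \<beta> / 2 * (norm (z - a))\<^sup>2 = \<beta> / 2 * (norm r)\<^sup>2"
    using \<beta> by (simp add: z_def power2_eq_square)
  also have "inner (grad a) (z - a) = - \<beta> * inner (grad b) r - \<beta> * (norm r)\<^sup>2"
    by (simp add: z_def r_def power2_norm_eq_inner algebra_simps)
  also have "inner (grad b) (z - b) = inner (grad b) (a - b) - \<beta> * inner (grad b) r"
    by (simp add: z_def algebra_simps)
  finally show ?thesis
    by (simp add: r_def)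
qed

lemma gradient_zero_at_minimizer:
  fixes f :: "'a::real_inner \<Rightarrow> real"
  assumes "GDERIV f z :> g" and "\<And>y. f z \<le> f y"
  shows "g = 0"
proof -
  have "(f has_derivative (\<lambda>h. inner h g)) (at z)"
    using assms(1) by (simp add: gderiv_def)
  then have "(\<lambda>h. inner h g) = (\<lambda>h. 0)"
    by (rule has_derivative_local_min) (use assms(2) in simp)
  then have "inner g g = 0"
    by meson
  then show ?thesis
    by simp
qed

section \<open>One step of the perturbed method\<close>

text \<open>Apply \<open>lb\<close> based at the new iterate and complete squares. Monotonicity
  drops the last square on the left, but the invariant below needs it.\<close>

lemma perturbed_step_decrease:
  fixes F :: "'a::real_inner \<Rightarrow> real"
  assumes lb: "\<And>a b. F b + inner (G b) (a - b) + (norm (G a - G b))\<^sup>2 / 2 \<le> F a"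
  shows "(norm (G x))\<^sup>2 - (norm e)\<^sup>2 + (norm (e + G (x - (G x + e))))\<^sup>2
    \<le> 2 * (F x - F (x - (G x + e)))"
proof -
  define q where "q = G (x - (G x + e))"
  have "(norm (G x))\<^sup>2 - (norm e)\<^sup>2 + (norm (e + q))\<^sup>2 = 2 * inner q (G x + e) + (norm (G x - q))\<^sup>2"
    by (simp add: power2_norm_eq_inner inner_add inner_diff inner_commute)
  moreover have "F (x - (G x + e)) + inner q (G x + e) + (norm (G x - q))\<^sup>2 / 2 \<le> F x"
    using lb[of "x - (G x + e)" x] by (simp add: q_def add.commute[of e])
  ultimately show ?thesis
    unfolding q_def[symmetric] by argo
qed

text \<open>
  The weighted AM--GM inequality for \<open>v = \<alpha>\<^sup>2 h + (1 - \<alpha>\<^sup>2) e\<close> together with convexity of the squared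
  norm balances the cross terms exactly.
\<close>

lemma perturbed_step_invariant:
  fixes F :: "'a::real_inner \<Rightarrow> real"
  assumes lb: "\<And>a b. F b + inner (G b) (a - b) + (norm (G a - G b))\<^sup>2 / 2 \<le> F a"
    and z: "G z = 0" and \<alpha>: "0 < \<alpha>" "\<alpha> \<le> 1" and N: "N > 0"
    and e: "norm e \<le> \<alpha> * norm (G x)" and x': "x' = x - (G x + e)"
    and inv: "(norm (x - G x - z))\<^sup>2 \<le> N * (K - 2 * (F x - F z))"
  shows "(norm (x' - G x' - z))\<^sup>2
    \<le> (N + 1) * ((1 - (1 - \<alpha>\<^sup>2) / (N + 1)) * K - 2 * (F x' - F z))"
proof -
  \<comment> \<open>\<open>w\<close> is the exact gradient step at \<open>x\<close> relative to
    \<open>z\<close>; the same quantity at \<open>x'\<close> is \<open>w - h\<close>.\<close>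
  define w where "w = x - G x - z"
  define h where "h = e + G x'"
  define a where "a = \<alpha>\<^sup>2"
  define v where "v = a *\<^sub>R h + (1 - a) *\<^sub>R e"
  define D D' where "D = F x - F z" and "D' = F x' - F z"
  have a: "0 < a" "a \<le> 1"
    using \<alpha> by (auto simp: a_def power_le_one)
  have ee: "(norm e)\<^sup>2 \<le> a * (norm (G x))\<^sup>2"
    using power_mono[OF e, of 2] by (simp add: a_def power_mult_distrib)
  have decr: "(norm (G x))\<^sup>2 - (norm e)\<^sup>2 + (norm h)\<^sup>2 \<le> 2 * (D - D')"
    using perturbed_step_decrease[OF lb, of x e] by (simp add: D_def D'_def h_def x')
  have D': "2 * D' \<le> 2 * inner h w - 2 * inner e w + (norm e)\<^sup>2 - (norm h)\<^sup>2"
  proof -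
    have "2 * D' \<le> 2 * inner (G x') (x' - z) - (norm (G x'))\<^sup>2"
      using lb[of x' z] by (simp add: D'_def z inner_diff)
    moreover have "x' - z = w - e" "G x' = h - e"
      by (simp_all add: x' w_def h_def)
    ultimately show ?thesis
      by (simp add: power2_norm_eq_inner inner_diff inner_commute)
  qed
  have A': "(norm (x' - G x' - z))\<^sup>2 = (norm w)\<^sup>2 - 2 * inner h w + (norm h)\<^sup>2"
  proof -
    have "x' - G x' - z = w - h"
      by (simp add: x' w_def h_def)
    then show ?thesis
      by (simp add: power2_norm_eq_inner inner_diff inner_commute)
  qed
  \<comment> \<open>The weight \<open>N / a\<close> is chosen so that the term in \<open>w\<close>
    matches the invariant multiplied by \<open>(N + a) / N\<close>, as used in
    \<open>K\<close>.\<close>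
  have young: "- 2 * inner v w \<le> a * (norm w)\<^sup>2 / N + N * (norm v)\<^sup>2 / a"
  proof -
    have "0 \<le> (norm (a *\<^sub>R w + N *\<^sub>R v))\<^sup>2 / (a * N)"
      using a N by simp
    also have "\<dots> = a * (norm w)\<^sup>2 / N + N * (norm v)\<^sup>2 / a + 2 * inner v w"
      using a N unfolding power2_norm_eq_inner
      by (simp add: inner_add inner_commute[of w v] field_simps power2_eq_square)
    finally show ?thesis
      by simp
  qed
  have "(norm v)\<^sup>2 = a * (norm h)\<^sup>2 + (1 - a) * (norm e)\<^sup>2 - a * (1 - a) * (norm (h - e))\<^sup>2"
    unfolding v_def power2_norm_eq_inner
    by (simp add: inner_add inner_diff inner_commute algebra_simps)
  also have "\<dots> \<le> a * (norm h)\<^sup>2 + (1 - a) * (norm e)\<^sup>2"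
    using a by simp
  \<comment> \<open>After cancellation this is exactly \<open>ee\<close>.\<close>
  also have "\<dots> \<le> a * ((norm (G x))\<^sup>2 - (norm e)\<^sup>2 + (norm h)\<^sup>2)"
    using ee by (simp add: algebra_simps)
  finally have vv: "(norm v)\<^sup>2 / a \<le> (norm (G x))\<^sup>2 - (norm e)\<^sup>2 + (norm h)\<^sup>2"
    using a by (simp add: pos_divide_le_eq mult.commute)
  have K: "2 * (N + a) * D + (norm w)\<^sup>2 + a * (norm w)\<^sup>2 / N \<le> (N + a) * K"
  proof -
    have "(N + a) * ((norm w)\<^sup>2 / N) \<le> (N + a) * (K - 2 * D)"
      using inv N a by (intro mult_left_mono) (auto simp: w_def D_def pos_divide_le_eq mult.commute)
    then show ?thesis
      using N by (simp add: algebra_simps add_divide_distrib)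
  qed
  \<comment> \<open>Split \<open>N + 1 = (N + a) + (1 - a)\<close>: the first weight goes to the
    descent inequality, the second to the comparison with \<open>z\<close>. The cross terms then add
    up to \<open>- 2 * inner v w\<close>, and what remains after \<open>young\<close>,
    \<open>vv\<close> and \<open>K\<close> is
    \<open>(norm e)\<^sup>2 - a * (norm (G x))\<^sup>2\<close>, nonpositive by
    \<open>ee\<close>.\<close>
  have "(N + a) * ((norm (G x))\<^sup>2 - (norm e)\<^sup>2 + (norm h)\<^sup>2) \<le> (N + a) * (2 * (D - D'))"
    using decr N a by (intro mult_left_mono) auto
  moreover have "(1 - a) * (2 * D')
      \<le> (1 - a) * (2 * inner h w - 2 * inner e w + (norm e)\<^sup>2 - (norm h)\<^sup>2)"
    using D' a by (intro mult_left_mono) auto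
  moreover have "N * ((norm v)\<^sup>2 / a) \<le> N * ((norm (G x))\<^sup>2 - (norm e)\<^sup>2 + (norm h)\<^sup>2)"
    using vv N by (intro mult_left_mono) auto
  moreover have "inner v w = a * inner h w + (1 - a) * inner e w"
    by (simp add: v_def inner_add)
  ultimately have "(norm (x' - G x' - z))\<^sup>2 \<le> (N + a) * K - 2 * (N + 1) * D'"
    using K young ee unfolding A' by (simp add: algebra_simps)
  also have "\<dots> = (N + 1) * ((1 - (1 - \<alpha>\<^sup>2) / (N + 1)) * K - 2 * (F x' - F z))"
    using N by (simp add: a_def D'_def field_simps)
  finally show ?thesis .
qed

section \<open>Induction over the iterations and vanishing of the product\<close>

lemma perturbed_gradient_method_bound:
  fixes F :: "'a::real_inner \<Rightarrow> real"
  assumes lb: "\<And>a b. F b + inner (G b) (a - b) + (norm (G a - G b))\<^sup>2 / 2 \<le> F a"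
    and z: "G z = 0" and \<alpha>: "\<And>n. 0 < \<alpha> n" "\<And>n. \<alpha> n \<le> 1"
    and e: "\<And>n. norm (e n) \<le> \<alpha> n * norm (G (x n))"
    and x: "\<And>n. x (Suc n) = x n - (G (x n) + e n)"
  shows "2 * (F (x n) - F z) \<le> (\<Prod>k<n. 1 - (1 - (\<alpha> k)\<^sup>2) / (real k + 2)) * (norm (x 0 - z))\<^sup>2"
proof -
  define K where "K n = (\<Prod>k<n. 1 - (1 - (\<alpha> k)\<^sup>2) / (real k + 2)) * (norm (x 0 - z))\<^sup>2" for n
  have "(norm (x n - G (x n) - z))\<^sup>2 \<le> (real n + 1) * (K n - 2 * (F (x n) - F z))"
  proof (induction n)
    case 0
    show ?case
      using lb[of "x 0" z] lb[of z "x 0"] z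
      by (simp add: K_def power2_norm_eq_inner inner_diff inner_commute)
  next
    \<comment> \<open>Here \<open>N = real n + 1\<close>, so the denominator \<open>N + 1\<close> is
      the \<open>real n + 2\<close> of the new factor.\<close>
    case (Suc n)
    show ?case
      using perturbed_step_invariant[OF lb z \<alpha>(1) \<alpha>(2) _ e x Suc.IH]
      by (simp add: K_def add_ac mult_ac)
  qed
  moreover have "0 \<le> (norm (x n - G (x n) - z))\<^sup>2"
    by simp
  ultimately have "0 \<le> (real n + 1) * (K n - 2 * (F (x n) - F z))"
    by linarith
  then have "0 \<le> K n - 2 * (F (x n) - F z)"
    by (simp add: zero_le_mult_iff)
  then show ?thesis
    by (simp add: K_def)
qed

text \<open>Each factor is at most \<open>exp (- d k)\<close>. The minorant \<open>d\<close> is kept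
  apart from \<open>c\<close> because the divergent series has \<open>1 - \<alpha>\<close> where the
  product has \<open>1 - \<alpha>\<^sup>2\<close>.\<close>

lemma prod_one_minus_tendsto_zero:
  fixes c d :: "nat \<Rightarrow> real"
  assumes c: "\<And>k. c k \<le> 1" and d: "\<And>k. d k \<le> c k"
    and div: "filterlim (\<lambda>n. \<Sum>k<n. d k) at_top sequentially"
  shows "(\<lambda>n. \<Prod>k<n. 1 - c k) \<longlonglongrightarrow> 0"
proof (rule real_tendsto_sandwich)
  show "\<forall>\<^sub>F n in sequentially. 0 \<le> (\<Prod>k<n. 1 - c k)"
    using c by (simp add: prod_nonneg)
  have "(\<Prod>k<n. 1 - c k) \<le> (\<Prod>k<n. exp (- d k))" for n
  proof (intro prod_mono conjI)
    fix k
    show "0 \<le> 1 - c k"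
      using c[of k] by simp
    show "1 - c k \<le> exp (- d k)"
      using exp_ge_add_one_self[of "- d k"] d[of k] by linarith
  qed
  then show "\<forall>\<^sub>F n in sequentially. (\<Prod>k<n. 1 - c k) \<le> exp (- (\<Sum>k<n. d k))"
    by (simp add: exp_sum sum_negf[symmetric])
  show "(\<lambda>n. exp (- (\<Sum>k<n. d k))) \<longlonglongrightarrow> 0"
    using div by (intro filterlim_compose[OF exp_at_bot])
      (simp add: filterlim_uminus_at_bot)
qed simp

theorem theorem3p1:
  fixes f :: "'a :: {real_inner, complete_space} \<Rightarrow> real"
    and grad :: "'a \<Rightarrow> 'a"
    and \<beta> :: real
    and \<alpha> :: "nat \<Rightarrow> real"
    and x \<Delta>x :: "nat \<Rightarrow> 'a"
  assumes "convex_on UNIV f"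
    and "\<And>y. GDERIV f y :> grad y"
    and "\<beta> > 0"
    and "(inverse \<beta>)-lipschitz_on UNIV grad"
    and "\<And>n. 0 < \<alpha> n"
    and "\<And>n. \<alpha> n \<le> 1"
    and "\<And>n. x (Suc n) = x n - \<beta> *\<^sub>R (grad (x n) + \<Delta>x n)"
    and "\<And>n. norm (\<Delta>x n) \<le> \<alpha> n * norm (grad (x n))"
  shows "decseq (\<lambda>n. f (x n)) \<and>
    (\<forall>xbar. (\<forall>y. f xbar \<le> f y) \<longrightarrow>
      (\<forall>n. f (x n) - f xbar
         \<le> 1 / (2 * \<beta>) * (\<Prod>k<n. 1 - (1 - (\<alpha> k)\<^sup>2) / (real k + 2)) * (norm (x 0 - xbar))\<^sup>2)) \<and>
    (filterlim (\<lambda>N. \<Sum>n<N. (1 - \<alpha> n) / (real n + 2)) at_top sequentially \<longrightarrow>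
      (\<forall>xbar. (\<forall>y. f xbar \<le> f y) \<longrightarrow> (\<lambda>n. f (x n)) \<longlonglongrightarrow> f xbar))"
proof -
  \<comment> \<open>Scaling the objective by \<open>\<beta>\<close> makes both the step size and the
    Lipschitz constant of the gradient equal to 1.\<close>
  define F where "F y = \<beta> * f y" for y
  define G where "G y = \<beta> *\<^sub>R grad y" for y
  define e where "e n = \<beta> *\<^sub>R \<Delta>x n" for n
  let ?P = "\<lambda>n. \<Prod>k<n. 1 - (1 - (\<alpha> k)\<^sup>2) / (real k + 2)"
  have lb: "F b + inner (G b) (a - b) + (norm (G a - G b))\<^sup>2 / 2 \<le> F a" for a b
  proof -
    have "norm (G a - G b) = \<beta> * norm (grad a - grad b)"
      using assms(3) by (simp add: G_def flip: scaleR_diff_right)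
    then show ?thesis
      using mult_left_mono[OF convex_lipschitz_gradient_lower_bound[OF assms(1-4), of b a], of \<beta>] assms(3)
      by (simp add: F_def G_def algebra_simps power2_eq_square)
  qed
  have x: "x (Suc n) = x n - (G (x n) + e n)" for n
    by (simp add: assms(7) G_def e_def algebra_simps)
  have e: "norm (e n) \<le> \<alpha> n * norm (G (x n))" for n
    using assms(3) assms(8)[of n] by (simp add: e_def G_def)
  have dec: "decseq (\<lambda>n. f (x n))"
  proof (rule decseq_SucI)
    fix n
    have "norm (e n) \<le> norm (G (x n))"
      using e[of n] mult_left_le_one_le[of "norm (G (x n))" "\<alpha> n"] assms(5,6)[of n] by force
    then have "(norm (e n))\<^sup>2 \<le> (norm (G (x n)))\<^sup>2"
      by (simp add: power_mono)
    moreover have "0 \<le> (norm (e n + G (x (Suc n))))\<^sup>2"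
      by simp
    ultimately have "F (x (Suc n)) \<le> F (x n)"
      using perturbed_step_decrease[OF lb, of "x n" "e n"] unfolding x[symmetric] by argo
    then show "f (x (Suc n)) \<le> f (x n)"
      using assms(3) by (simp add: F_def)
  qed
  have bound: "f (x n) - f z \<le> 1 / (2 * \<beta>) * ?P n * (norm (x 0 - z))\<^sup>2"
    if "\<forall>y. f z \<le> f y" for z n
  proof -
    have "G z = 0"
      using gradient_zero_at_minimizer[OF assms(2)] that by (simp add: G_def)
    define p where "p = ?P n * (norm (x 0 - z))\<^sup>2"
    have "2 * (F (x n) - F z) \<le> p"
      unfolding p_def
      by (rule perturbed_gradient_method_bound[where F = F and G = G and x = x and e = e,
            OF lb \<open>G z = 0\<close> assms(5,6) e x])
    then have "f (x n) - f z \<le> 1 / (2 * \<beta>) * p"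
      using assms(3) by (simp add: F_def field_simps)
    then show ?thesis
      by (simp only: p_def mult.assoc)
  qed
  have lim: "(\<lambda>n. f (x n)) \<longlonglongrightarrow> f z"
    if div: "filterlim (\<lambda>N. \<Sum>n<N. (1 - \<alpha> n) / (real n + 2)) at_top sequentially"
      and z: "\<forall>y. f z \<le> f y" for z
  proof (rule real_tendsto_sandwich)
    show "\<forall>\<^sub>F n in sequentially. f z \<le> f (x n)"
      using z by simp
    show "\<forall>\<^sub>F n in sequentially. f (x n) \<le> 1 / (2 * \<beta>) * ?P n * (norm (x 0 - z))\<^sup>2 + f z"
      by (intro always_eventually allI bound[OF z, unfolded diff_le_eq])
    have "(1 - (\<alpha> k)\<^sup>2) / (real k + 2) \<le> 1" for k
      using order_trans[of "- (\<alpha> k)\<^sup>2" 0 "1 + real k"] by (simp add: divide_le_eq)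
    \<comment> \<open>Since \<open>0 < \<alpha> k \<le> 1\<close>, squaring does not increase
      \<open>\<alpha> k\<close>.\<close>
    moreover have "(1 - \<alpha> k) / (real k + 2) \<le> (1 - (\<alpha> k)\<^sup>2) / (real k + 2)" for k
      using assms(5,6)[of k] by (intro divide_right_mono) (auto simp: power2_eq_square mult_left_le)
    ultimately have "?P \<longlonglongrightarrow> 0"
      using div by (rule prod_one_minus_tendsto_zero[where d = "\<lambda>k. (1 - \<alpha> k) / (real k + 2)"])
    then have "(\<lambda>n. 1 / (2 * \<beta>) * ?P n * (norm (x 0 - z))\<^sup>2 + f z)
        \<longlonglongrightarrow> 1 / (2 * \<beta>) * 0 * (norm (x 0 - z))\<^sup>2 + f z"
      by (intro tendsto_intros)
    then show "(\<lambda>n. 1 / (2 * \<beta>) * ?P n * (norm (x 0 - z))\<^sup>2 + f z) \<longlonglongrightarrow> f z"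
      by simp
  qed simp
  show ?thesis
    by (intro conjI allI impI; rule dec bound lim; assumption)
qed

end
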